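(* Let $1\le p<\infty$, let $X=(X,d,\mu)$ be a metric measure space, let $U\subset X$ be a measurable $p$-path open set and $E\subset U$. Then $C_p(E)=0$ if and only if $C_p^U(E)=0$.
   Context: Setting: $1\le p<\infty$, and $X=(X,d,\mu)$ is a metric space with metric $d$ and a positive complete Borel measure $\mu$ such that $\mu(B)<\infty$ for all open balls $B\subset X$. Curves: a curve is a continuous mapping from an interval. Only compact rectifiable curves are considered; they are nonconstant unless otherwise stated and parameterized by arc length $ds$, so $\gamma:[0,l_\gamma]\to X$ with $l_\gamma$ the length of $\gamma$. A property holds for $p$-almost every ($p$-a.e.) curve if it fails only for a curve family $\Gamma$ for which there is a nonnegative Borel function $\rho\in L^p(X)$ with $\int_\gamma\rho\,ds=\infty$ for every $\gamma\in\Gamma$. Upper gradients: a nonnegative Borel function $g$ on $X$ is an upper gradient of $f:X\to[-\infty,\infty]$ if $|f(\gamma(0))-f(\gamma(l_\gamma))|\le\int_\gamma g\,ds$ for all nonconstant compact rectifiable curves $\gamma:[0,l_\gamma]\to X$, where the left-hand side is $\infty$ whenever at least one of its terms is infinite. Newtonian space and capacity: for measurable $f:X\to[-\infty,\infty]$ (defined everywhere), $\|f\|_{N^{1,p}(X)}=\bigl(\int_X|f|^p\,d\mu+\inf_g\int_X g^p\,d\mu\bigr)^{1/p}$, with infimum over all upper gradients $g$ of $f$, and $N^{1,p}(X)=\{f:\|f\|_{N^{1,p}(X)}<\infty\}$. For $E\subset X$, $C_p(E)=\inf_u\|u\|_{N^{1,p}(X)}^p$, the infimum being over all $u\in N^{1,p}(X)$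 with $u\ge1$ on $E$. For a measurable set $U\subset X$, $N^{1,p}(U)$ and the intrinsic capacity $C_p^U$ are defined in the same way with $X$ replaced by the metric measure space $(U,d|_U,\mu|_U)$. A set $U\subset X$ is $p$-path open if for $p$-a.e. curve $\gamma:[0,l_\gamma]\to X$ the set $\gamma^{-1}(U)$ is relatively open in $[0,l_\gamma]$. *)

theory Defs
  imports "HOL-Analysis.Analysis"
begin

text \<open>
  A metric measure space is represented by a measure \<open>M\<close> over a type of class
  \<^class>\<open>metric_space\<close>; its underlying set is \<^term>\<open>space M\<close>, an arbitrary subset of the type,
  with the restricted metric.
  All notions below are relative to \<^term>\<open>space M\<close>, so that their versions for a measurable
  subset \<open>U\<close>, equipped with the restrictions of metric and measure, are obtained by
  replacing \<open>M\<close> by \<^term>\<open>restrict_space M U\<close>.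
\<close>

text \<open>
  A complete Borel measure is the completion of a measure on the Borel sets. As balls have
  finite measure, this is the same as a Borel regular complete measure for which all Borel
  sets are measurable.
\<close>

definition metric_measure_space :: "'a::metric_space measure \<Rightarrow> bool" where
  "metric_measure_space M \<longleftrightarrow>
     (\<exists>N. sets N = sets (restrict_space borel (space M)) \<and> M = completion N) \<and>
     (\<forall>x\<in>space M. \<forall>r. emeasure M (ball x r \<inter> space M) < \<infinity>)"

definition borel_on :: "'a::topological_space set \<Rightarrow> ('a \<Rightarrow> ennreal) set" where
  "borel_on S = borel_measurable (restrict_space borel S)"

definition ennpowr :: "ennreal \<Rightarrow> real \<Rightarrow> ennreal" where
  "ennpowr x a = (if x = \<infinity> then \<infinity> else ennreal (enn2real x powr a))"


section \<open>Curves\<close>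

definition curve_length :: "(real \<Rightarrow> 'a::metric_space) \<Rightarrow> real \<Rightarrow> real \<Rightarrow> ennreal" where
  "curve_length \<gamma> a b =
     (SUP (n, t) \<in> {(n :: nat, t :: nat \<Rightarrow> real). t 0 = a \<and> t n = b \<and> mono_on {..n} t}.
        \<Sum>i<n. ennreal (dist (\<gamma> (t i)) (\<gamma> (t (Suc i)))))"

text \<open>
  The pair \<open>(\<gamma>, l)\<close> represents the curve \<open>\<gamma> : [0, l] \<rightarrow> S\<close>, which is rectifiable, nonconstant
  and parameterized by arc length; the values of \<open>\<gamma>\<close> outside \<open>[0, l]\<close> are irrelevant.
\<close>

definition arclength_curve ::
    "'a::metric_space set \<Rightarrow> (real \<Rightarrow> 'a) \<Rightarrow> real \<Rightarrow> bool" where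
  "arclength_curve S \<gamma> l \<longleftrightarrow>
     0 < l \<and> continuous_on {0..l} \<gamma> \<and> \<gamma> ` {0..l} \<subseteq> S \<and>
     (\<forall>s t. 0 \<le> s \<and> s \<le> t \<and> t \<le> l \<longrightarrow> curve_length \<gamma> s t = ennreal (t - s))"

definition curve_integral ::
    "(real \<Rightarrow> 'a) \<Rightarrow> real \<Rightarrow> ('a \<Rightarrow> ennreal) \<Rightarrow> ennreal" where
  "curve_integral \<gamma> l \<rho> = (\<integral>\<^sup>+s\<in>{0..l}. \<rho> (\<gamma> s) \<partial>lborel)"

definition ae_curve ::
    "real \<Rightarrow> 'a::metric_space measure \<Rightarrow> ((real \<Rightarrow> 'a) \<Rightarrow> real \<Rightarrow> bool) \<Rightarrow> bool" where
  "ae_curve p M P \<longleftrightarrow>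
     (\<exists>\<rho> \<in> borel_on (space M).
        (\<integral>\<^sup>+x. ennpowr (\<rho> x) p \<partial>M) < \<infinity> \<and>
        (\<forall>\<gamma> l. arclength_curve (space M) \<gamma> l \<and> \<not> P \<gamma> l \<longrightarrow> curve_integral \<gamma> l \<rho> = \<infinity>))"

definition path_open :: "real \<Rightarrow> 'a::metric_space measure \<Rightarrow> 'a set \<Rightarrow> bool" where
  "path_open p M U \<longleftrightarrow>
     U \<subseteq> space M \<and>
     ae_curve p M (\<lambda>\<gamma> l. openin (top_of_set {0..l}) {s \<in> {0..l}. \<gamma> s \<in> U})"


section \<open>Newtonian spaces and capacity\<close>

text \<open>
  The first case is the convention for infinite values; subtraction on \<^typ>\<open>ereal\<close> is total.
\<close>

definition end_diff :: "ereal \<Rightarrow> ereal \<Rightarrow> ennreal" where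
  "end_diff a b = (if \<bar>a\<bar> = \<infinity> \<or> \<bar>b\<bar> = \<infinity> then \<infinity> else e2ennreal \<bar>a - b\<bar>)"

definition upper_gradient ::
    "'a::metric_space set \<Rightarrow> ('a \<Rightarrow> ereal) \<Rightarrow> ('a \<Rightarrow> ennreal) \<Rightarrow> bool" where
  "upper_gradient S f g \<longleftrightarrow>
     g \<in> borel_on S \<and>
     (\<forall>\<gamma> l. arclength_curve S \<gamma> l \<longrightarrow> end_diff (f (\<gamma> 0)) (f (\<gamma> l)) \<le> curve_integral \<gamma> l g)"

definition newtonian_norm :: "real \<Rightarrow> 'a::metric_space measure \<Rightarrow> ('a \<Rightarrow> ereal) \<Rightarrow> ennreal" where
  "newtonian_norm p M f =
     ennpowr ((\<integral>\<^sup>+x. ennpowr (e2ennreal \<bar>f x\<bar>) p \<partial>M) +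
              (INF g \<in> {g. upper_gradient (space M) f g}. \<integral>\<^sup>+x. ennpowr (g x) p \<partial>M))
       (1 / p)"

definition newtonian_space :: "real \<Rightarrow> 'a::metric_space measure \<Rightarrow> ('a \<Rightarrow> ereal) set" where
  "newtonian_space p M = {f \<in> borel_measurable M. newtonian_norm p M f < \<infinity>}"

definition capacity :: "real \<Rightarrow> 'a::metric_space measure \<Rightarrow> 'a set \<Rightarrow> ennreal" where
  "capacity p M E =
     (INF u \<in> {u \<in> newtonian_space p M. \<forall>x\<in>E. 1 \<le> u x}. ennpowr (newtonian_norm p M u) p)"

end

theory Submission
  imports Defs
begin

text \<open>
  The intrinsic capacity is smaller because admissible functions and their upper gradients
  can be restricted to \<open>U\<close>. For the converse, choose admissible functions \<open>u\<^sub>k\<close> on \<open>U\<close> with upper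
  gradients \<open>g\<^sub>k\<close> such that \<open>\<rho> = sup\<^sub>k 2\<^sup>k max {g\<^sub>k, \<bar>u\<^sub>k\<bar>}\<close>, extended by zero, is in \<open>L\<^sup>p\<close>, replace
  \<open>\<rho>\<close> by a Borel majorant that agrees with it almost everywhere, and take the maximum with a
  function witnessing that \<open>U\<close> is path open. If a curve \<open>\<gamma>\<close> with \<open>\<integral>\<^sub>\<gamma> \<rho> ds < \<infinity>\<close> met \<open>E\<close> at \<open>x\<close>, it
  would have a subcurve in \<open>U\<close> from \<open>x\<close> to some \<open>y\<close> with \<open>\<rho> y < \<infinity>\<close>, whence
  \<open>1 \<le> \<bar>u\<^sub>k x\<bar> \<le> 2\<^sup>-\<^sup>k (\<rho> y + \<integral>\<^sub>\<gamma> \<rho> ds)\<close> for all \<open>k\<close>, which is absurd. Moreover \<open>\<rho> = \<infinity>\<close> on \<open>E\<close>, so \<open>E\<close>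
  is null, and all positive multiples of \<open>\<rho>\<close> are upper gradients of the indicator of \<open>E\<close>.
\<close>

section \<open>Powers\<close>

lemma ennpowr_mono:
  assumes "0 \<le> a" "x \<le> y"
  shows "ennpowr x a \<le> ennpowr y a"
proof (cases "y = \<infinity>")
  case False
  with assms show ?thesis
    unfolding ennpowr_def
    by (auto intro!: ennreal_leI powr_mono2 enn2real_mono simp: top.not_eq_extremum top_unique)
qed (simp add: ennpowr_def)

lemma ennpowr_measurable [measurable]: "(\<lambda>x. ennpowr x a) \<in> borel_measurable borel"
  unfolding ennpowr_def by measurable

lemma ennpowr_zero [simp]: "ennpowr 0 a = 0"
  by (simp add: ennpowr_def)

lemma ennpowr_ennpowr:
  assumes "a * b = 1"
  shows "ennpowr (ennpowr x a) b = x"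
  using assms by (cases x) (auto simp: ennpowr_def powr_powr)

lemma ennpowr_cmult:
  assumes "0 \<le> c"
  shows "ennpowr (ennreal c * x) a = ennreal (c powr a) * ennpowr x a"
proof (cases x)
  case (real r)
  with assms show ?thesis
    by (simp add: ennpowr_def ennreal_mult[symmetric] powr_mult)
next
  case top
  with assms show ?thesis
    by (auto simp: ennpowr_def ennreal_mult_top)
qed

lemma ennpowr_max_le:
  "ennpowr (max x y) a \<le> ennpowr x a + ennpowr y a"
  by (cases "x \<le> y") (auto simp: max_def)

text \<open>Every term of a series of nonnegative terms is at most its sum. Taking roots turns this
  into a bound on each \<open>h k\<close>, which passes to the supremum, and raising to the power
  \<open>a\<close> again uses only monotonicity, not continuity of the power.\<close>

lemma ennpowr_SUP_le_suminf:
  assumes "0 < a"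
  shows "ennpowr (SUP k. h k) a \<le> (\<Sum>k::nat. ennpowr (h k) a)"
proof -
  have "ennpowr (h k) a \<le> (\<Sum>k. ennpowr (h k) a)" for k
    using sum_le_suminf[of "\<lambda>k. ennpowr (h k) a" "{k}"] by (simp add: summableI)
  then have "ennpowr (ennpowr (h k) a) (1 / a) \<le> ennpowr (\<Sum>k. ennpowr (h k) a) (1 / a)" for k
    using assms by (intro ennpowr_mono) auto
  then have "(SUP k. h k) \<le> ennpowr (\<Sum>k. ennpowr (h k) a) (1 / a)"
    using assms by (intro SUP_least) (simp add: ennpowr_ennpowr)
  then have "ennpowr (SUP k. h k) a \<le> ennpowr (ennpowr (\<Sum>k. ennpowr (h k) a) (1 / a)) a"
    using assms by (intro ennpowr_mono) auto
  then show ?thesis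
    using assms by (simp add: ennpowr_ennpowr)
qed

section \<open>Curves\<close>

lemma curve_length_upper:
  assumes "t 0 = a" "t n = b" "mono_on {..n} t"
  shows "(\<Sum>i<n. ennreal (dist (\<gamma> (t i)) (\<gamma> (t (Suc i))))) \<le> curve_length \<gamma> a b"
  unfolding curve_length_def by (rule SUP_upper2[of "(n, t)"]) (use assms in auto)

lemma curve_length_shift_le:
  "curve_length (\<lambda>s. \<gamma> (a + s)) s t \<le> curve_length \<gamma> (a + s) (a + t)"
  unfolding curve_length_def[of "\<lambda>s. \<gamma> (a + s)"]
proof (rule SUP_least, safe)
  fix n and \<tau> :: "nat \<Rightarrow> real"
  assume "mono_on {..n} \<tau>"
  then show "(\<Sum>i<n. ennreal (dist (\<gamma> (a + \<tau> i)) (\<gamma> (a + \<tau> (Suc i)))))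
      \<le> curve_length \<gamma> (a + \<tau> 0) (a + \<tau> n)"
    by (intro curve_length_upper[where t="\<lambda>i. a + \<tau> i"]) (auto simp: mono_on_def)
qed

text \<open>The reverse inequality is \<open>curve_length_shift_le\<close> for the shifted curve and
  the opposite shift \<open>- a\<close>.\<close>

lemma curve_length_shift:
  "curve_length (\<lambda>s. \<gamma> (a + s)) s t = curve_length \<gamma> (a + s) (a + t)"
  using curve_length_shift_le[of \<gamma> a s t]
    curve_length_shift_le[of "\<lambda>s. \<gamma> (a + s)" "- a" "a + s" "a + t"]
  by (simp add: antisym)

text \<open>The target \<open>T\<close> is independent of \<open>S\<close>, so that a piece of a
  curve in the whole space that stays in \<open>U\<close> becomes a curve in \<open>U\<close>, to
  which upper gradients on \<open>U\<close> apply.\<close>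

lemma arclength_subcurve:
  assumes \<gamma>: "arclength_curve S \<gamma> l" and ab: "0 \<le> a" "a < b" "b \<le> l" and T: "\<gamma> ` {a..b} \<subseteq> T"
  shows "arclength_curve T (\<lambda>s. \<gamma> (a + s)) (b - a)"
  unfolding arclength_curve_def
proof (intro conjI allI impI)
  have "continuous_on {0..l} \<gamma>"
    using \<gamma> by (simp add: arclength_curve_def)
  moreover have "continuous_on {0..b - a} ((+) a)" "(+) a ` {0..b - a} \<subseteq> {0..l}"
    using ab by (auto intro!: continuous_intros)
  ultimately show "continuous_on {0..b - a} (\<lambda>s. \<gamma> (a + s))"
    by (rule continuous_on_compose2)
  show "(\<lambda>s. \<gamma> (a + s)) ` {0..b - a} \<subseteq> T"
    using T by auto
  fix s t assume "0 \<le> s \<and> s \<le> t \<and> t \<le> b - a"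
  then show "curve_length (\<lambda>s. \<gamma> (a + s)) s t = ennreal (t - s)"
    using \<gamma> ab by (simp add: curve_length_shift arclength_curve_def)
qed (use ab in auto)

lemma arclength_curve_mono:
  "arclength_curve S \<gamma> l \<Longrightarrow> S \<subseteq> T \<Longrightarrow> arclength_curve T \<gamma> l"
  by (auto simp: arclength_curve_def)

section \<open>Integrals along curves\<close>

lemma borel_measurable_along_curve:
  assumes \<gamma>: "arclength_curve S \<gamma> l" and \<rho>: "\<rho> \<in> borel_on S"
  shows "(\<lambda>s. \<rho> (\<gamma> s) * indicator {0..l} s) \<in> borel_measurable borel"
proof -
  have "\<gamma> \<in> borel_measurable (restrict_space borel {0..l})"
    using \<gamma> by (intro borel_measurable_continuous_on_restrict) (simp add: arclength_curve_def)
  then have "\<gamma> \<in> restrict_space borel {0..l} \<rightarrow>\<^sub>M restrict_space borel S"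
    using \<gamma> by (intro measurable_restrict_space2) (auto simp: arclength_curve_def)
  then have "(\<lambda>s. \<rho> (\<gamma> s)) \<in> borel_measurable (restrict_space borel {0..l})"
    using \<rho> unfolding borel_on_def by (rule measurable_compose)
  then show ?thesis
    by (subst (asm) borel_measurable_restrict_space_iff_ennreal) auto
qed

lemma curve_integral_cmult:
  assumes "arclength_curve S \<gamma> l" "\<rho> \<in> borel_on S"
  shows "curve_integral \<gamma> l (\<lambda>x. c * \<rho> x) = c * curve_integral \<gamma> l \<rho>"
  using borel_measurable_along_curve[OF assms]
  by (simp add: curve_integral_def mult.assoc nn_integral_cmult)

lemma curve_integral_mono:
  assumes "arclength_curve S \<gamma> l" "\<And>x. x \<in> S \<Longrightarrow> g x \<le> h x"
  shows "curve_integral \<gamma> l g \<le> curve_integral \<gamma> l h"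
  using assms unfolding curve_integral_def arclength_curve_def
  by (intro nn_integral_mono) (auto simp: indicator_def image_subset_iff)

text \<open>Translation invariance of Lebesgue measure moves the long integral to the parameters of
  the subcurve, where the two integrands differ only by their cut-offs.\<close>

lemma curve_integral_subcurve_le:
  assumes \<gamma>: "arclength_curve S \<gamma> l" and \<rho>: "\<rho> \<in> borel_on S" and ab: "0 \<le> a" "b \<le> l"
  shows "curve_integral (\<lambda>s. \<gamma> (a + s)) (b - a) \<rho> \<le> curve_integral \<gamma> l \<rho>"
proof -
  have "curve_integral \<gamma> l \<rho> = (\<integral>\<^sup>+s. \<rho> (\<gamma> (a + s)) * indicator {0..l} (a + s) \<partial>lborel)"
    unfolding curve_integral_def
    using nn_integral_real_affine[OF borel_measurable_along_curve[OF \<gamma> \<rho>], of 1 a] by simp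
  moreover have "curve_integral (\<lambda>s. \<gamma> (a + s)) (b - a) \<rho> \<le> \<dots>"
    unfolding curve_integral_def using ab by (intro nn_integral_mono) (auto simp: indicator_def)
  ultimately show ?thesis by simp
qed

text \<open>A finite integral makes the integrand finite almost everywhere, and
  \<open>{a..b}\<close> has positive length even after one point is removed. The removal of
  \<open>s\<close> ensures that \<open>s\<close> and \<open>t\<close> bound a nonconstant
  subcurve.\<close>

lemma finite_value_on_curve:
  assumes \<gamma>: "arclength_curve S \<gamma> l" and \<rho>: "\<rho> \<in> borel_on S"
    and fin: "curve_integral \<gamma> l \<rho> < \<infinity>" and ab: "0 \<le> a" "a < b" "b \<le> l"
  shows "\<exists>t\<in>{a..b} - {s}. \<rho> (\<gamma> t) < \<infinity>"
proof (rule ccontr)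
  assume "\<not> ?thesis"
  then have contra: "\<rho> (\<gamma> t) = \<infinity>" if "t \<in> {a..b}" "t \<noteq> s" for t
    using that by (auto simp: less_top[symmetric])
  have "AE t in lborel. \<rho> (\<gamma> t) * indicator {0..l} t \<noteq> \<infinity>"
    using fin borel_measurable_along_curve[OF \<gamma> \<rho>]
    by (intro nn_integral_PInf_AE) (auto simp: curve_integral_def)
  moreover have "AE t in lborel. t \<noteq> s"
    by (rule AE_lborel_singleton)
  ultimately have "AE t in lborel. t \<notin> {a..b}"
  proof eventually_elim
    case (elim t)
    show ?case
    proof
      assume t: "t \<in> {a..b}"
      then have "t \<in> {0..l}"
        using ab by simp
      then show False
        using elim contra[OF t] by simp
    qed
  qed
  then have "emeasure lborel {a..b} = 0"
    by (subst (asm) AE_iff_measurable[of "{a..b}"]) auto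
  then show False
    using ab by simp
qed

section \<open>Change of a function along a curve\<close>

lemma end_diff_commute: "end_diff a b = end_diff b a"
  by (cases a; cases b) (auto simp: end_diff_def)

lemma abs_le_plus_end_diff: "e2ennreal \<bar>a\<bar> \<le> e2ennreal \<bar>b\<bar> + end_diff a b"
proof (cases "\<bar>a\<bar> = \<infinity> \<or> \<bar>b\<bar> = \<infinity>")
  case False
  then obtain x y where "a = ereal x" "b = ereal y"
    by (cases a; cases b) auto
  then show ?thesis
    by (simp add: end_diff_def ennreal_plus[symmetric] del: ennreal_plus)
qed (simp add: end_diff_def)

text \<open>The upper gradient inequality is applied to the piece of the curve between
  \<open>s\<close> and \<open>t\<close>, which lies in \<open>U\<close>; the resulting integral is
  then enlarged to the whole curve, on which only \<open>\<rho>\<close> is known to be Borel. The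
  symmetry of \<open>end_diff\<close> covers both orders of \<open>s\<close> and
  \<open>t\<close>.\<close>

lemma abs_le_plus_curve_integral:
  assumes ug: "upper_gradient U u g" and \<gamma>: "arclength_curve S \<gamma> l"
    and \<rho>: "\<rho> \<in> borel_on S" and g: "\<And>x. x \<in> U \<Longrightarrow> g x \<le> c * \<rho> x" and "U \<subseteq> S"
    and ab: "0 \<le> a" "b \<le> l" "\<gamma> ` {a..b} \<subseteq> U" and st: "s \<in> {a..b}" "t \<in> {a..b}" "s \<noteq> t"
  shows "e2ennreal \<bar>u (\<gamma> s)\<bar> \<le> e2ennreal \<bar>u (\<gamma> t)\<bar> + c * curve_integral \<gamma> l \<rho>"
proof -
  have *: "end_diff (u (\<gamma> v)) (u (\<gamma> w)) \<le> c * curve_integral \<gamma> l \<rho>"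
    if "v \<in> {a..b}" "w \<in> {a..b}" "v < w" for v w
  proof -
    have sub: "arclength_curve U (\<lambda>s. \<gamma> (v + s)) (w - v)"
      using that ab by (intro arclength_subcurve[OF \<gamma>]) auto
    have "end_diff (u (\<gamma> v)) (u (\<gamma> w)) \<le> curve_integral (\<lambda>s. \<gamma> (v + s)) (w - v) g"
      using ug sub unfolding upper_gradient_def by fastforce
    also have "\<dots> \<le> curve_integral (\<lambda>s. \<gamma> (v + s)) (w - v) (\<lambda>x. c * \<rho> x)"
      by (rule curve_integral_mono[OF sub g])
    also have "\<dots> = c * curve_integral (\<lambda>s. \<gamma> (v + s)) (w - v) \<rho>"
      by (rule curve_integral_cmult[OF arclength_curve_mono[OF sub \<open>U \<subseteq> S\<close>] \<rho>])
    also have "\<dots> \<le> c * curve_integral \<gamma> l \<rho>"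
      using that ab by (intro mult_left_mono curve_integral_subcurve_le[OF \<gamma> \<rho>]) auto
    finally show ?thesis .
  qed
  have "end_diff (u (\<gamma> s)) (u (\<gamma> t)) \<le> c * curve_integral \<gamma> l \<rho>"
  proof (cases "s < t")
    case True
    then show ?thesis using *[of s t] st by simp
  next
    case False
    then show ?thesis using *[of t s] st by (simp add: end_diff_commute)
  qed
  then show ?thesis
    using abs_le_plus_end_diff[of "u (\<gamma> s)" "u (\<gamma> t)"] by (meson add_left_mono order_trans)
qed

section \<open>Null sets of the capacity\<close>

lemma borel_on_subset_borel_measurable:
  assumes "metric_measure_space M"
  shows "borel_on (space M) \<subseteq> borel_measurable M"
proof -
  obtain N where N: "sets N = sets (restrict_space borel (space M))" "M = completion N"
    using assms by (auto simp: metric_measure_space_def)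
  then have "borel_on (space M) = borel_measurable N"
    unfolding borel_on_def by (intro measurable_cong_sets) auto
  then show ?thesis
    using N measurable_completion by auto
qed

text \<open>A function measurable for the completion agrees with a Borel function off a Borel null
  set; the value \<infinity> on that set makes it a majorant. Domination is needed at every point,
  since a curve may run inside a null set.\<close>

lemma borel_majorant:
  fixes f :: "'a::metric_space \<Rightarrow> ennreal"
  assumes "metric_measure_space M" "f \<in> borel_measurable M"
  obtains h where "h \<in> borel_on (space M)" "\<And>x. x \<in> space M \<Longrightarrow> f x \<le> h x"
    "AE x in M. f x = h x"
proof -
  obtain N where N: "sets N = sets (restrict_space borel (space M))" "M = completion N"
    using assms by (auto simp: metric_measure_space_def)
  have "f \<in> borel_measurable (completion N)"
    using assms(2) N(2) by simp
  then obtain g where g: "g \<in> borel_measurable N" "AE x in N. f x = g x"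
    using completion_ex_borel_measurable by blast
  obtain Z where Z: "{x \<in> space N. f x \<noteq> g x} \<subseteq> Z" "Z \<in> null_sets N"
    using g(2) unfolding eventually_ae_filter by blast
  define h where "h x = (if x \<in> Z then \<infinity> else g x)" for x
  have "h \<in> borel_measurable N"
    using g(1) Z(2) unfolding h_def by (intro measurable_If_set) auto
  moreover have "borel_on (space M) = borel_measurable N"
    unfolding borel_on_def using N by (intro measurable_cong_sets) auto
  moreover have "f x \<le> h x" if "x \<in> space M" for x
    using Z(1) that N(2) by (auto simp: h_def)
  moreover have "AE x in M. f x = h x"
    unfolding N(2) AE_completion_iff using AE_not_in[OF Z(2)] g(2)
    by eventually_elim (simp add: h_def)
  ultimately show thesis
    using that by auto
qed

section \<open>Criteria for capacity zero\<close>

lemma ennpowr_newtonian_norm: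
  assumes "0 < p"
  shows "ennpowr (newtonian_norm p M f) p =
     (\<integral>\<^sup>+x. ennpowr (e2ennreal \<bar>f x\<bar>) p \<partial>M) +
     (INF g \<in> {g. upper_gradient (space M) f g}. \<integral>\<^sup>+x. ennpowr (g x) p \<partial>M)"
  unfolding newtonian_norm_def using assms by (intro ennpowr_ennpowr) auto

text \<open>\<open>ennpowr\<close> takes the value \<infinity> only at \<infinity>, so membership in
  the Newtonian space can be tested on the power \<open>p\<close> of the norm, which is free of
  roots.\<close>

lemma newtonian_norm_finite_iff:
  "newtonian_norm p M f < top \<longleftrightarrow> ennpowr (newtonian_norm p M f) p < top"
  by (auto simp: ennpowr_def less_top)

lemma capacity_zero_obtains:
  fixes M :: "'a::metric_space measure"
  assumes "0 < p" "capacity p M E = 0" "0 < \<epsilon>"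
  obtains u g where "u \<in> borel_measurable M" "\<forall>x\<in>E. 1 \<le> u x" "upper_gradient (space M) u g"
    "(\<integral>\<^sup>+x. ennpowr (e2ennreal \<bar>u x\<bar>) p \<partial>M) + (\<integral>\<^sup>+x. ennpowr (g x) p \<partial>M) < \<epsilon>"
proof -
  have "capacity p M E < \<epsilon>"
    using assms by simp
  then obtain u where u: "u \<in> newtonian_space p M" "\<forall>x\<in>E. 1 \<le> u x"
    and lt: "ennpowr (newtonian_norm p M u) p < \<epsilon>"
    unfolding capacity_def by (auto simp: INF_less_iff)
  define A where "A = (\<integral>\<^sup>+x. ennpowr (e2ennreal \<bar>u x\<bar>) p \<partial>M)"
  have "A + (INF g \<in> {g. upper_gradient (space M) u g}. \<integral>\<^sup>+x. ennpowr (g x) p \<partial>M) < \<epsilon>"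
    using lt assms by (simp add: ennpowr_newtonian_norm A_def)
  \<comment> \<open>Only a finite \<open>A\<close> can be moved across the inequality in
    \<open>ennreal\<close>; this isolates the infimum over upper gradients, from which
    \<open>g\<close> is then picked.\<close>
  moreover from this have "A < \<infinity>"
    by (auto simp: less_top[symmetric])
  ultimately have "(INF g \<in> {g. upper_gradient (space M) u g}. \<integral>\<^sup>+x. ennpowr (g x) p \<partial>M) < \<epsilon> - A"
    by (simp add: less_diff_eq_ennreal add.commute less_top)
  then obtain g where g: "upper_gradient (space M) u g" "(\<integral>\<^sup>+x. ennpowr (g x) p \<partial>M) < \<epsilon> - A"
    by (auto simp: INF_less_iff)
  then have "A + (\<integral>\<^sup>+x. ennpowr (g x) p \<partial>M) < \<epsilon>"
    using \<open>A < \<infinity>\<close> by (simp add: less_diff_eq_ennreal add.commute less_top)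
  then show thesis
    using that[of u g] u g by (simp add: newtonian_space_def A_def)
qed

lemma capacity_zeroI:
  fixes M :: "'a::metric_space measure"
  assumes p: "0 < p" and "metric_measure_space M" and E: "E \<in> null_sets M"
    and \<rho>: "\<rho> \<in> borel_on (space M)" "(\<integral>\<^sup>+x. ennpowr (\<rho> x) p \<partial>M) < \<infinity>"
    and curve: "\<And>\<gamma> l s. arclength_curve (space M) \<gamma> l \<Longrightarrow> s \<in> {0..l} \<Longrightarrow> \<gamma> s \<in> E \<Longrightarrow>
      curve_integral \<gamma> l \<rho> = \<infinity>"
  shows "capacity p M E = 0"
proof -
  define u :: "'a \<Rightarrow> ereal" where "u = indicator E"
  define I where "I = (\<integral>\<^sup>+x. ennpowr (\<rho> x) p \<partial>M)"
  have [measurable]: "\<rho> \<in> borel_measurable M"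
    using borel_on_subset_borel_measurable \<rho>(1) assms(2) by auto
  have ug: "upper_gradient (space M) u (\<lambda>x. ennreal c * \<rho> x)" if "0 < c" for c
    unfolding upper_gradient_def
  proof (intro conjI allI impI)
    show "(\<lambda>x. ennreal c * \<rho> x) \<in> borel_on (space M)"
      using \<rho>(1) unfolding borel_on_def by measurable
    fix \<gamma> l assume \<gamma>: "arclength_curve (space M) \<gamma> l"
    then have "0 < l" by (simp add: arclength_curve_def)
    show "end_diff (u (\<gamma> 0)) (u (\<gamma> l)) \<le> curve_integral \<gamma> l (\<lambda>x. ennreal c * \<rho> x)"
    \<comment> \<open>An end in \<open>E\<close> makes the right-hand side infinite, as
      \<open>c\<close> is positive; otherwise the indicator vanishes at both ends.\<close>
    proof (cases "\<gamma> 0 \<in> E \<or> \<gamma> l \<in> E")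
      case True
      then have "curve_integral \<gamma> l \<rho> = \<infinity>"
        using curve[OF \<gamma>, of 0] curve[OF \<gamma>, of l] \<open>0 < l\<close> by auto
      then show ?thesis
        using \<open>0 < c\<close> by (simp add: curve_integral_cmult[OF \<gamma> \<rho>(1)] ennreal_mult_top)
    next
      case False
      then show ?thesis by (simp add: u_def end_diff_def zero_ereal_def)
    qed
  qed
  have "(\<integral>\<^sup>+x. ennpowr (e2ennreal \<bar>u x\<bar>) p \<partial>M) = (\<integral>\<^sup>+x. 0 \<partial>M)"
    using AE_not_in[OF E]
    by (intro nn_integral_cong_AE) (auto simp: u_def zero_ereal_def elim!: eventually_mono)
  then have A: "(\<integral>\<^sup>+x. ennpowr (e2ennreal \<bar>u x\<bar>) p \<partial>M) = 0"
    by simp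
  have le: "ennpowr (newtonian_norm p M u) p \<le> ennreal (c powr p) * I" if "0 < c" for c
  proof -
    have "ennpowr (newtonian_norm p M u) p \<le> (\<integral>\<^sup>+x. ennpowr (ennreal c * \<rho> x) p \<partial>M)"
      unfolding ennpowr_newtonian_norm[OF p] A add_0
      by (rule INF_lower) (simp add: ug[OF that])
    also have "\<dots> = ennreal (c powr p) * I"
      using that by (simp add: ennpowr_cmult nn_integral_cmult I_def)
    finally show ?thesis .
  qed
  have "ennpowr (newtonian_norm p M u) p \<le> 0 + ennreal e" if "0 < e" for e
  proof -
    obtain r where r: "0 \<le> r" "I = ennreal r"
      using \<rho>(2) by (cases I) (auto simp: I_def)
    \<comment> \<open>The scaling gives \<open>c powr p * r = e * r / (r + 1)\<close>, which is at
      most \<open>e\<close>; the summand 1 covers \<open>r = 0\<close>.\<close>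
    define c where "c = (e / (r + 1)) powr (1 / p)"
    have "0 < c" "c powr p = e / (r + 1)"
      using p \<open>0 < e\<close> r by (auto simp: c_def powr_powr)
    then have "ennpowr (newtonian_norm p M u) p \<le> ennreal (e / (r + 1)) * ennreal r"
      using le[of c] r by simp
    also have "\<dots> = ennreal (e / (r + 1) * r)"
      using r \<open>0 < e\<close> by (subst ennreal_mult) auto
    also have "\<dots> \<le> ennreal e"
      using r \<open>0 < e\<close> by (intro ennreal_leI) (simp add: field_simps)
    finally show ?thesis by simp
  qed
  then have norm: "ennpowr (newtonian_norm p M u) p \<le> 0"
    by (rule ennreal_le_epsilon)
  have "u \<in> borel_measurable M"
    using E unfolding u_def by (intro borel_measurable_indicator) auto
  then have "u \<in> newtonian_space p M"
    using norm p by (simp add: newtonian_space_def newtonian_norm_finite_iff)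
  then have "capacity p M E \<le> ennpowr (newtonian_norm p M u) p"
    unfolding capacity_def by (intro INF_lower) (simp add: u_def)
  then show ?thesis
    using norm by simp
qed

section \<open>Comparison of the two capacities\<close>

lemma capacity_restrict_space_le:
  fixes M :: "'a::metric_space measure"
  assumes p: "0 < p" and U: "U \<in> sets M"
  shows "capacity p (restrict_space M U) E \<le> capacity p M E"
proof -
  have sp: "space (restrict_space M U) = U" "U \<inter> space M = U" "U \<subseteq> space M"
    using sets.sets_into_space[OF U] by (auto simp: space_restrict_space)
  have int: "(\<integral>\<^sup>+x. h x \<partial>restrict_space M U) \<le> (\<integral>\<^sup>+x. h x \<partial>M)" for h
    using U sp by (subst nn_integral_restrict_space) (auto intro!: nn_integral_mono simp: indicator_def)
  have ug: "upper_gradient U u g" if "upper_gradient (space M) u g" for u g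
    unfolding upper_gradient_def
  proof (intro conjI allI impI)
    show "g \<in> borel_on U"
      unfolding borel_on_def
      by (rule measurable_restrict_mono[OF _ sp(3)])
        (use that in \<open>simp add: upper_gradient_def borel_on_def\<close>)
    fix \<gamma> l assume "arclength_curve U \<gamma> l"
    then have "arclength_curve (space M) \<gamma> l"
      using sp(3) by (rule arclength_curve_mono)
    then show "end_diff (u (\<gamma> 0)) (u (\<gamma> l)) \<le> curve_integral \<gamma> l g"
      using that by (simp add: upper_gradient_def)
  qed
  \<comment> \<open>On \<open>U\<close> the infimum runs over at least as many upper gradients, and
    each integral is over a smaller set.\<close>
  have norm: "ennpowr (newtonian_norm p (restrict_space M U) u) p \<le> ennpowr (newtonian_norm p M u) p" for u
    unfolding ennpowr_newtonian_norm[OF p] sp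
    by (intro add_mono int INF_mono) (use ug int in auto)
  show ?thesis
    unfolding capacity_def
  proof (rule INF_mono)
    fix u assume "u \<in> {u \<in> newtonian_space p M. \<forall>x\<in>E. 1 \<le> u x}"
    then have "u \<in> newtonian_space p (restrict_space M U)" "\<forall>x\<in>E. 1 \<le> u x"
      using norm[of u] p
      by (auto simp: newtonian_space_def newtonian_norm_finite_iff measurable_restrict_space1
          intro: le_less_trans)
    then show "\<exists>v\<in>{u \<in> newtonian_space p (restrict_space M U). \<forall>x\<in>E. 1 \<le> u x}.
        ennpowr (newtonian_norm p (restrict_space M U) v) p \<le> ennpowr (newtonian_norm p M u) p"
      using norm by blast
  qed
qed

lemma capacity_zero_of_restrict_space:
  fixes M :: "'a::metric_space measure"
  assumes p: "0 < p" and M: "metric_measure_space M" and U: "U \<in> sets M"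
    and open_U: "path_open p M U" and "E \<subseteq> U"
    and cap: "capacity p (restrict_space M U) E = 0"
  shows "capacity p M E = 0"
proof -
  define R where "R = restrict_space M U"
  have sp: "space R = U" "U \<inter> space M = U" "U \<subseteq> space M"
    using sets.sets_into_space[OF U] by (auto simp: space_restrict_space R_def)
  \<comment> \<open>The denominator cancels the factor that the weight \<open>2 ^ k\<close> in
    \<open>h k\<close> contributes to the integral, leaving a summable geometric bound.\<close>
  define \<epsilon> :: "nat \<Rightarrow> real" where "\<epsilon> k = (1/2) ^ k / (2 ^ k) powr p" for k
  have "\<forall>k. \<exists>u g. u \<in> borel_measurable R \<and> (\<forall>x\<in>E. 1 \<le> u x) \<and> upper_gradient U u g \<and>
    (\<integral>\<^sup>+x. ennpowr (e2ennreal \<bar>u x\<bar>) p \<partial>R) + (\<integral>\<^sup>+x. ennpowr (g x) p \<partial>R) < ennreal (\<epsilon> k)"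
  proof
    fix k
    have "0 < ennreal (\<epsilon> k)" by (simp add: \<epsilon>_def)
    from capacity_zero_obtains[OF p cap this]
    show "\<exists>u g. u \<in> borel_measurable R \<and> (\<forall>x\<in>E. 1 \<le> u x) \<and> upper_gradient U u g \<and>
      (\<integral>\<^sup>+x. ennpowr (e2ennreal \<bar>u x\<bar>) p \<partial>R) + (\<integral>\<^sup>+x. ennpowr (g x) p \<partial>R) < ennreal (\<epsilon> k)"
      using sp unfolding R_def by metis
  qed
  then obtain u g where [measurable]: "\<And>k. u k \<in> borel_measurable R"
    and u1: "\<And>k x. x \<in> E \<Longrightarrow> 1 \<le> u k x" and ug: "\<And>k. upper_gradient U (u k) (g k)"
    and small: "\<And>k. (\<integral>\<^sup>+x. ennpowr (e2ennreal \<bar>u k x\<bar>) p \<partial>R) + (\<integral>\<^sup>+x. ennpowr (g k x) p \<partial>R)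
      < ennreal (\<epsilon> k)"
    by metis
  \<comment> \<open>The \<open>g k\<close> are Borel only relative to \<open>U\<close>, which is
    merely measurable for the completion; their measurability for \<open>R\<close> comes from traces
    of Borel sets on \<open>U\<close>.\<close>
  have "sets (restrict_space borel U) \<subseteq> sets R"
  proof -
    obtain N where N: "sets N = sets (restrict_space borel (space M))" "M = completion N"
      using M by (auto simp: metric_measure_space_def)
    have "sets (restrict_space borel U) = sets (restrict_space N U)"
      using sp(2,3) sets_restrict_space_cong[OF N(1), of U]
      by (simp add: restrict_restrict_space[symmetric] sets_restrict_restrict_space Int_absorb1)
    also have "\<dots> \<subseteq> sets R"
      unfolding R_def N(2) by (auto simp: sets_restrict_space)
    finally show ?thesis .
  qed
  moreover have "g k \<in> borel_measurable (restrict_space borel U)" for k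
    using ug[of k] by (simp add: upper_gradient_def borel_on_def)
  ultimately have [measurable]: "g k \<in> borel_measurable R" for k
    using sp(1) by (auto simp: measurable_def space_restrict_space)
  define h where "h k x = ennreal (2 ^ k) * max (g k x) (e2ennreal \<bar>u k x\<bar>)" for k x
  have [measurable]: "h k \<in> borel_measurable R" for k
    unfolding h_def by measurable
  have int_h: "(\<integral>\<^sup>+x. ennpowr (h k x) p \<partial>R) \<le> ennreal ((1/2) ^ k)" for k
  proof -
    have "(\<integral>\<^sup>+x. ennpowr (h k x) p \<partial>R)
        \<le> (\<integral>\<^sup>+x. ennreal ((2 ^ k) powr p) * (ennpowr (e2ennreal \<bar>u k x\<bar>) p + ennpowr (g k x) p) \<partial>R)"
      unfolding h_def
      by (intro nn_integral_mono)
        (auto simp: ennpowr_cmult add.commute intro!: mult_left_mono ennpowr_max_le)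
    also have "\<dots> = ennreal ((2 ^ k) powr p) *
        ((\<integral>\<^sup>+x. ennpowr (e2ennreal \<bar>u k x\<bar>) p \<partial>R) + (\<integral>\<^sup>+x. ennpowr (g k x) p \<partial>R))"
      by (simp add: nn_integral_cmult nn_integral_add)
    also have "\<dots> \<le> ennreal ((2 ^ k) powr p) * ennreal (\<epsilon> k)"
      using small[of k] by (intro mult_left_mono) auto
    also have "\<dots> = ennreal ((1/2) ^ k)"
      by (simp add: \<epsilon>_def ennreal_mult[symmetric])
    finally show ?thesis .
  qed
  define f where "f x = (SUP k. h k x) * indicator U x" for x
  have "(\<lambda>x. SUP k. h k x) \<in> borel_measurable R"
    by measurable
  then have f_meas: "f \<in> borel_measurable M"
    unfolding f_def R_def using U sp by (subst (asm) borel_measurable_restrict_space_iff_ennreal) auto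
  have "(\<integral>\<^sup>+x. ennpowr (f x) p \<partial>M) = (\<integral>\<^sup>+x. ennpowr (SUP k. h k x) p \<partial>R)"
    unfolding R_def using U sp
    by (subst nn_integral_restrict_space) (auto intro!: nn_integral_cong simp: f_def indicator_def)
  also have "\<dots> \<le> (\<integral>\<^sup>+x. (\<Sum>k. ennpowr (h k x) p) \<partial>R)"
    by (intro nn_integral_mono ennpowr_SUP_le_suminf p)
  also have "\<dots> = (\<Sum>k. \<integral>\<^sup>+x. ennpowr (h k x) p \<partial>R)"
    by (intro nn_integral_suminf) measurable
  also have "\<dots> \<le> (\<Sum>k. ennreal ((1/2) ^ k))"
    by (intro suminf_le int_h summableI)
  also have "\<dots> < \<infinity>"
    by (subst suminf_ennreal2) (auto intro: summable_geometric)
  finally have f_int: "(\<integral>\<^sup>+x. ennpowr (f x) p \<partial>M) < \<infinity>" .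
  \<comment> \<open>Extension by zero from \<open>U\<close> yields only measurability for
    \<open>M\<close>, whereas integration along curves calls for a Borel function.\<close>
  obtain \<rho>1 where \<rho>1: "\<rho>1 \<in> borel_on (space M)" "\<And>x. x \<in> space M \<Longrightarrow> f x \<le> \<rho>1 x"
    "AE x in M. f x = \<rho>1 x"
    using borel_majorant[OF M f_meas] by blast
  obtain \<rho>0 where \<rho>0: "\<rho>0 \<in> borel_on (space M)" "(\<integral>\<^sup>+x. ennpowr (\<rho>0 x) p \<partial>M) < \<infinity>"
    and exc: "\<And>\<gamma> l. arclength_curve (space M) \<gamma> l \<Longrightarrow>
      \<not> openin (top_of_set {0..l}) {s \<in> {0..l}. \<gamma> s \<in> U} \<Longrightarrow> curve_integral \<gamma> l \<rho>0 = \<infinity>"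
    using open_U unfolding path_open_def ae_curve_def by blast
  define \<rho> where "\<rho> x = max (\<rho>0 x) (\<rho>1 x)" for x
  have \<rho>_borel: "\<rho> \<in> borel_on (space M)"
    using \<rho>0(1) \<rho>1(1) unfolding \<rho>_def borel_on_def by measurable
  have [measurable]: "\<rho>0 \<in> borel_measurable M" "\<rho>1 \<in> borel_measurable M" "\<rho> \<in> borel_measurable M"
    using borel_on_subset_borel_measurable[OF M] \<rho>0(1) \<rho>1(1) \<rho>_borel by auto
  have "(\<integral>\<^sup>+x. ennpowr (\<rho> x) p \<partial>M) \<le> (\<integral>\<^sup>+x. ennpowr (\<rho>0 x) p + ennpowr (\<rho>1 x) p \<partial>M)"
    unfolding \<rho>_def by (intro nn_integral_mono ennpowr_max_le)
  also have "\<dots> = (\<integral>\<^sup>+x. ennpowr (\<rho>0 x) p \<partial>M) + (\<integral>\<^sup>+x. ennpowr (\<rho>1 x) p \<partial>M)"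
    by (intro nn_integral_add) measurable
  also have "(\<integral>\<^sup>+x. ennpowr (\<rho>1 x) p \<partial>M) = (\<integral>\<^sup>+x. ennpowr (f x) p \<partial>M)"
    using \<rho>1(3) by (intro nn_integral_cong_AE) auto
  finally have \<rho>_int: "(\<integral>\<^sup>+x. ennpowr (\<rho> x) p \<partial>M) < \<infinity>"
    using \<rho>0(2) f_int by (auto simp: less_top[symmetric] top_unique)
  have h_le: "h k x \<le> \<rho> x" if "x \<in> U" for k x
  proof -
    have "h k x \<le> f x"
      using that SUP_upper[of k UNIV "\<lambda>k. h k x"] by (simp add: f_def)
    then show ?thesis
      using \<rho>1(2)[of x] that sp(3) by (auto simp: \<rho>_def le_max_iff_disj intro: order_trans)
  qed
  have scale: "a \<le> ennreal ((1/2) ^ k) * \<rho> x"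
    if "x \<in> U" "a \<le> max (g k x) (e2ennreal \<bar>u k x\<bar>)" for a x k
  proof -
    have "a = ennreal ((1/2) ^ k) * (ennreal (2 ^ k) * a)"
      by (simp add: mult.assoc[symmetric] ennreal_mult[symmetric] power_one_over)
    also have "\<dots> \<le> ennreal ((1/2) ^ k) * h k x"
      unfolding h_def using that by (intro mult_left_mono) auto
    also have "\<dots> \<le> ennreal ((1/2) ^ k) * \<rho> x"
      using h_le[OF that(1)] by (intro mult_left_mono) auto
    finally show ?thesis .
  qed
  have g_le: "g k x \<le> ennreal ((1/2) ^ k) * \<rho> x"
    and u_le: "e2ennreal \<bar>u k x\<bar> \<le> ennreal ((1/2) ^ k) * \<rho> x" if "x \<in> U" for k x
    using that by (auto intro: scale)
  have one_le: "1 \<le> e2ennreal \<bar>u k x\<bar>" if "x \<in> E" for k x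
    using u1[OF that, of k] by (cases "u k x") auto
  have infinite: "b = \<infinity>" if "\<And>k. 1 \<le> ennreal ((1/2) ^ k) * b" for b
  proof (rule ccontr)
    assume "b \<noteq> \<infinity>"
    then obtain r where r: "0 \<le> r" "b = ennreal r"
      by (cases b) auto
    obtain k where "r < 2 ^ k"
      using real_arch_pow[of 2 r] by auto
    then have "(1/2) ^ k * r < 1"
      by (simp add: power_one_over field_simps)
    then show False
      using that[of k] r by (simp add: ennreal_mult[symmetric] ennreal_1[symmetric] del: ennreal_1)
  qed
  have curve: "curve_integral \<gamma> l \<rho> = \<infinity>"
    if \<gamma>: "arclength_curve (space M) \<gamma> l" and s: "s \<in> {0..l}" "\<gamma> s \<in> E" for \<gamma> l s
  proof (rule ccontr)
    assume "curve_integral \<gamma> l \<rho> \<noteq> \<infinity>"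
    then have fin: "curve_integral \<gamma> l \<rho> < \<infinity>"
      by (simp add: less_top)
    \<comment> \<open>Finiteness for \<open>\<rho>\<close> thus keeps the curve out of the
      exceptional family, so its parameters in \<open>U\<close> form a relatively open set.\<close>
    have "curve_integral \<gamma> l \<rho>0 \<le> curve_integral \<gamma> l \<rho>"
      by (rule curve_integral_mono[OF \<gamma>]) (simp add: \<rho>_def)
    then have "openin (top_of_set {0..l}) {s \<in> {0..l}. \<gamma> s \<in> U}"
      using exc[OF \<gamma>] fin by fastforce
    then obtain e where e: "0 < e" "\<And>t. t \<in> {0..l} \<Longrightarrow> dist t s < e \<Longrightarrow> \<gamma> t \<in> U"
      using s \<open>E \<subseteq> U\<close> unfolding openin_euclidean_subtopology_iff by blast
    \<comment> \<open>Halving \<open>e\<close> keeps the closed interval \<open>{a..b}\<close>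
      inside the open neighbourhood of \<open>s\<close>. After truncation to \<open>{0..l}\<close>
      it is still nondegenerate, even if \<open>s\<close> is an end of the curve, because
      \<open>0 < l\<close>.\<close>
    define a where "a = max 0 (s - e / 2)"
    define b where "b = min l (s + e / 2)"
    have "0 < l"
      using \<gamma> by (simp add: arclength_curve_def)
    then have ab: "0 \<le> a" "a < b" "b \<le> l" "s \<in> {a..b}"
      using s e(1) by (auto simp: a_def b_def)
    have sub: "\<gamma> ` {a..b} \<subseteq> U"
      using e by (auto simp: a_def b_def dist_real_def abs_if)
    obtain t where t: "t \<in> {a..b}" "t \<noteq> s" "\<rho> (\<gamma> t) < \<infinity>"
      using finite_value_on_curve[OF \<gamma> \<rho>_borel fin ab(1-3)] by blast
    \<comment> \<open>The point \<open>t\<close> was chosen before \<open>k\<close>, so the factor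
      in parentheses is a fixed finite number while its coefficient tends to zero.\<close>
    have "1 \<le> ennreal ((1/2) ^ k) * (\<rho> (\<gamma> t) + curve_integral \<gamma> l \<rho>)" for k
    proof -
      have "1 \<le> e2ennreal \<bar>u k (\<gamma> s)\<bar>"
        by (rule one_le[OF s(2)])
      also have "\<dots> \<le> e2ennreal \<bar>u k (\<gamma> t)\<bar> + ennreal ((1/2) ^ k) * curve_integral \<gamma> l \<rho>"
        using t ab by (intro abs_le_plus_curve_integral[OF ug \<gamma> \<rho>_borel g_le sp(3) _ _ sub]) auto
      also have "\<dots> \<le> ennreal ((1/2) ^ k) * \<rho> (\<gamma> t) + ennreal ((1/2) ^ k) * curve_integral \<gamma> l \<rho>"
        using t(1) sub by (intro add_right_mono u_le) auto
      finally show ?thesis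
        by (simp add: distrib_left)
    qed
    then have "\<rho> (\<gamma> t) + curve_integral \<gamma> l \<rho> = \<infinity>"
      by (rule infinite)
    then show False
      using t(3) fin by auto
  qed
  have "\<rho> x = \<infinity>" if "x \<in> E" for x
    using that one_le u_le \<open>E \<subseteq> U\<close> by (intro infinite) (blast intro: order_trans)
  moreover have "AE x in M. ennpowr (\<rho> x) p \<noteq> \<infinity>"
    using \<rho>_int by (intro nn_integral_PInf_AE) auto
  ultimately have "AE x in M. x \<notin> E"
    by (auto simp: ennpowr_def elim!: eventually_mono)
  then obtain Z where Z: "{x \<in> space M. \<not> x \<notin> E} \<subseteq> Z" "Z \<in> null_sets M"
    unfolding eventually_ae_filter by blast
  \<comment> \<open>\<open>E\<close> is an arbitrary subset of \<open>U\<close>; completeness turns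
    its inclusion in a null set into measurability.\<close>
  obtain N where "M = completion N"
    using M by (auto simp: metric_measure_space_def)
  moreover have "E \<subseteq> Z"
    using Z(1) \<open>E \<subseteq> U\<close> sp(3) by auto
  ultimately have "E \<in> null_sets M"
    using Z(2) null_sets_completion_subset by blast
  then show ?thesis
    using curve by (intro capacity_zeroI[OF p M _ \<rho>_borel \<rho>_int])
qed

theorem proposition4p2:
  fixes p :: real
    and M :: "'a::metric_space measure"
    and U E :: "'a set"
  assumes "1 \<le> p"
    and "metric_measure_space M"
    and "U \<in> sets M"
    and "path_open p M U"
    and "E \<subseteq> U"
  shows "capacity p M E = 0 \<longleftrightarrow> capacity p (restrict_space M U) E = 0"
  using capacity_restrict_space_le[of p U M E] capacity_zero_of_restrict_space[of p M U E] assms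
  by auto

end
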